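(* Let $T>0$, let $m,n\ge 1$ be integers, let $n-1<\alpha\le n$ and $\alpha>\alpha_1>\alpha_2>\cdots>\alpha_m>0$, and for $i=1,\dots,m$ let $n_i$ be the positive integer with $n_i-1<\alpha_i\le n_i$. Put $\alpha_0=0$. Let $x_0^0,\dots,x_{n-1}^0\in\mathbb R$, and let $f:[0,T]\times\mathbb R^{m+1}\to\mathbb R$ be such that $f(t,z_0,\dots,z_m)$ is continuous with respect to $t$, $$|f(t,z_0,\dots,z_m)-f(t,z_0',\dots,z_m')|\le L\sum_{i=0}^m|z_i-z_i'|$$ and $$L\sum_{i=0}^{m}\frac{1}{\Gamma(\alpha-\alpha_i+1)}<1 .$$ Let $t_j=jh$, $j=0,\dots,N$, with $h=T/N$. Then there exists a unique $y_N\in S_1$ such that $$y_N(t_j)=f\Big(t_j,\;I^\alpha y_N(t_j)+\sum_{k=0}^{n-1}x_k^0\frac{t_j^k}{k!},\;\big\{I^{\alpha-\alpha_i}y_N(t_j)+p_i(t_j)\big\}_{i=1}^m\Big),\qquad j=0,1,\dots,N,$$ where $p_i=D^{\alpha_i}\Big(\sum_{k=n_i}^{n-1}x_k^0\frac{t^k}{k!}\Big)$.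
   Context: For $\beta>0$, $I^\beta y(t)=\frac1{\Gamma(\beta)}\int_0^t(t-\tau)^{\beta-1}y(\tau)\,d\tau$ is the fractional integral of order $\beta$. $D^{\beta}$ is the Riemann–Liouville fractional derivative of order $\beta$, $D^\beta u(t)=\frac{d^l}{dt^l}\frac{1}{\Gamma(l-\beta)}\int_0^t(t-\tau)^{l-\beta-1}u(\tau)\,d\tau$ for $l-1<\beta\le l$ (and $D^l=\frac{d^l}{dt^l}$ if $\beta=l$); an empty sum is $0$. $S_1$ is the space of continuous functions on $[0,T]$ that are linear on each interval $[t_{j-1},t_j]$, $j=1,\dots,N$.
   Formalization: The formal statement adds the hypothesis h = T/N ≤ 1; without it uniqueness fails, e.g. m=1, n=2, α=2, α_1=1, x=0, f=z_0/2, L=1/2, T=√12, N=1, where every y(t)=ct solves the equations. *)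

theory Defs
  imports "HOL-Analysis.Analysis"
begin

(* 0 powr (beta - 1) = 0, so the kernel is 0 at tau = t even for beta <= 1; this single point
   does not affect the integral. *)
definition frac_integral :: "real \<Rightarrow> (real \<Rightarrow> real) \<Rightarrow> real \<Rightarrow> real" where
  "frac_integral \<beta> y t =
     1 / Gamma \<beta> * integral {0..t} (\<lambda>\<tau>. (t - \<tau>) powr (\<beta> - 1) * y \<tau>)"

(* Functions live on [0,T], so derivatives are taken within [0,T]:
   they are one-sided at 0 and at T. *)
definition deriv_within :: "real \<Rightarrow> (real \<Rightarrow> real) \<Rightarrow> real \<Rightarrow> real" where
  "deriv_within T u t = vector_derivative u (at t within {0..T})"

definition RL_deriv :: "real \<Rightarrow> real \<Rightarrow> (real \<Rightarrow> real) \<Rightarrow> real \<Rightarrow> real" where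
  "RL_deriv T \<beta> u =
     (let l = nat \<lceil>\<beta>\<rceil> in
      if \<beta> = real l then (deriv_within T ^^ l) u
      else (deriv_within T ^^ l) (frac_integral (real l - \<beta>) u))"

definition taylor_part :: "(nat \<Rightarrow> real) \<Rightarrow> nat \<Rightarrow> nat \<Rightarrow> real \<Rightarrow> real" where
  "taylor_part x l n t = (\<Sum>k\<in>{l..<n}. x k * t ^ k / fact k)"

(* The contraction constant in the theorem carries no power of the mesh size h = T / N, so
   uniqueness can fail if h > 1, whence the condition h <= 1: for m = 1, alpha = 2, alpha_1 = 1, f(t,z) = z_0 / 2, x = 0,
   N = 1 and T = sqrt 12, every y(t) = c t solves the equations, although L = 1/2 gives 3/4 < 1. *)
definition node :: "real \<Rightarrow> nat \<Rightarrow> nat \<Rightarrow> real" where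
  "node T N j = real j * (T / real N)"

(* A function on [0,T] is represented by its extensional version, so that
   uniqueness in S_1 is equality on [0,T]. *)
definition S1 :: "real \<Rightarrow> nat \<Rightarrow> (real \<Rightarrow> real) set" where
  "S1 T N = {y \<in> extensional {0..T}. continuous_on {0..T} y \<and>
     (\<forall>j\<in>{1..N}. \<exists>a b. \<forall>t\<in>{node T N (j - 1)..node T N j}. y t = a + b * t)}"

(* R^(m+1), with coordinates 0, ..., m. *)
definition coord_space :: "nat \<Rightarrow> (nat \<Rightarrow> real) set" where
  "coord_space m = {..m} \<rightarrow>\<^sub>E UNIV"

definition collocation_arg ::
  "real \<Rightarrow> nat \<Rightarrow> nat \<Rightarrow> real \<Rightarrow> (nat \<Rightarrow> real) \<Rightarrow> (nat \<Rightarrow> nat) \<Rightarrow> (nat \<Rightarrow> real)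
    \<Rightarrow> (real \<Rightarrow> real) \<Rightarrow> real \<Rightarrow> nat \<Rightarrow> real" where
  "collocation_arg T m n \<alpha> a \<nu> x y t = (\<lambda>i\<in>{..m}.
     if i = 0 then frac_integral \<alpha> y t + taylor_part x 0 n t
     else frac_integral (\<alpha> - a i) y t + RL_deriv T (a i) (taylor_part x (\<nu> i) n) t)"

end

(* The equations are causal: in the j-th one the values at earlier nodes are already known, and
   I^beta y(t_j) depends on the value y(t_j) through the integral over the last mesh interval only,
   with Lipschitz constant at most h^beta / Gamma(beta + 1) <= 1 / Gamma(beta + 1).  So the node
   values are found one after the other, each as the fixed point of a contraction of the real line. *)
theory Submission
  imports Defs
begin

section \<open>Causal systems of scalar equations\<close>

text \<open>Sequences that agree up to and including \<open>j\<close> give the bound 0, so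
  \<open>G j\<close> ignores all entries after \<open>j\<close>. A solution of the first
  \<open>N\<close> equations therefore survives any change of entry \<open>N\<close>, and that entry
  can be chosen by Banach's fixed point theorem.\<close>

lemma causal_contraction_solution:
  fixes G :: "nat \<Rightarrow> (nat \<Rightarrow> real) \<Rightarrow> real"
  assumes c: "0 \<le> c" "c < 1"
    and G: "\<And>j v w. j < N \<Longrightarrow> (\<And>k. k < j \<Longrightarrow> v k = w k) \<Longrightarrow> \<bar>G j v - G j w\<bar> \<le> c * \<bar>v j - w j\<bar>"
  shows "\<exists>v. \<forall>j<N. v j = G j v"
  using G
proof (induction N)
  case 0
  show ?case by simp
next
  case (Suc N)
  then obtain v where v: "\<And>j. j < N \<Longrightarrow> v j = G j v"
    by (metis less_SucI)
  have "\<forall>s s'. dist (G N (v(N := s))) (G N (v(N := s'))) \<le> c * dist s s'"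
  proof (intro allI)
    show "dist (G N (v(N := s))) (G N (v(N := s'))) \<le> c * dist s s'" for s s'
      using Suc.prems[of N "v(N := s)" "v(N := s')"] by (simp add: dist_real_def fun_upd_def)
  qed
  then obtain s where s: "G N (v(N := s)) = s"
    using banach_fix_type[OF c, of "\<lambda>s. G N (v(N := s))"] by blast
  have "(v(N := s)) j = G j (v(N := s))" if "j < Suc N" for j
  proof (cases "j = N")
    case False
    then have "j < N" using that by simp
    \<comment> \<open>The update at \<open>N > j\<close> leaves the entries up to \<open>j\<close>
      alone, so the contraction bound here is \<open>c * 0\<close>.\<close>
    then have "G j (v(N := s)) = G j v"
      using Suc.prems[of j "v(N := s)" v] by (simp add: fun_upd_def)
    then show ?thesis using v[OF \<open>j < N\<close>] False by simp
  qed (use s in simp)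
  then show ?case by blast
qed

section \<open>Estimates for the fractional integral\<close>

text \<open>For \<beta> < 1 the kernel is unbounded near \<open>t\<close>, but its antiderivative
  \<open>- ((t - \<tau>) powr \<beta> / \<beta>)\<close> is continuous up to \<open>t\<close>. The
  fundamental theorem that asks for derivatives only in the interior thus applies.\<close>

lemma has_integral_frac_kernel:
  fixes \<beta> p t :: real
  assumes "0 < \<beta>" "p \<le> t"
  shows "((\<lambda>\<tau>. (t - \<tau>) powr (\<beta> - 1)) has_integral (t - p) powr \<beta> / \<beta>) {p..t}"
proof -
  have "((\<lambda>\<tau>. (t - \<tau>) powr (\<beta> - 1)) has_integral
      (- ((t - t) powr \<beta> / \<beta>)) - (- ((t - p) powr \<beta> / \<beta>))) {p..t}"
  proof (rule fundamental_theorem_of_calculus_interior[OF assms(2)])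
    show "continuous_on {p..t} (\<lambda>\<tau>. - ((t - \<tau>) powr \<beta> / \<beta>))"
      using assms by (intro continuous_intros continuous_on_powr') auto
    show "((\<lambda>\<tau>. - ((t - \<tau>) powr \<beta> / \<beta>)) has_vector_derivative (t - \<tau>) powr (\<beta> - 1)) (at \<tau>)"
      if "\<tau> \<in> {p<..<t}" for \<tau>
      unfolding has_real_derivative_iff_has_vector_derivative[symmetric]
      using that assms by (auto intro!: derivative_eq_intros)
  qed
  then show ?thesis using assms by simp
qed

text \<open>The kernel is nonnegative and integrable, hence absolutely integrable, and the
  continuous factor \<open>y\<close> is bounded and measurable on the compact interval.\<close>

lemma frac_kernel_mult_integrable:
  fixes \<beta> t :: real
  assumes "0 < \<beta>" "0 \<le> t" "continuous_on {0..t} y"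
  shows "(\<lambda>\<tau>. (t - \<tau>) powr (\<beta> - 1) * y \<tau>) integrable_on {0..t}"
proof -
  have "(\<lambda>\<tau>. (t - \<tau>) powr (\<beta> - 1)) absolutely_integrable_on {0..t}"
    using has_integral_frac_kernel[OF assms(1,2)]
    by (intro nonnegative_absolutely_integrable_1) (auto simp: integrable_on_def)
  moreover have "y \<in> borel_measurable (lebesgue_on {0..t})"
    using assms(3) by (intro continuous_imp_measurable_on_sets_lebesgue) auto
  moreover have "bounded (y ` {0..t})"
    using assms(3) by (intro compact_imp_bounded compact_continuous_image) auto
  ultimately have "(\<lambda>\<tau>. y \<tau> * (t - \<tau>) powr (\<beta> - 1)) absolutely_integrable_on {0..t}"
    by (intro absolutely_integrable_bounded_measurable_product_real) auto
  then show ?thesis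
    by (simp add: absolutely_integrable_on_def mult.commute)
qed

text \<open>Only \<open>{p..t}\<close> contributes. There the kernel has mass
  \<open>(t - p) powr \<beta> / \<beta>\<close>, which is at most \<open>1 / \<beta>\<close> because
  \<open>t - p \<le> 1\<close>.\<close>

lemma frac_integral_diff_le:
  fixes \<beta> p t M :: real
  assumes \<beta>: "0 < \<beta>" and p: "0 \<le> p" "p \<le> t" "t - p \<le> 1"
    and y: "continuous_on {0..t} y" and z: "continuous_on {0..t} z"
    and early: "\<And>\<tau>. 0 \<le> \<tau> \<Longrightarrow> \<tau> < p \<Longrightarrow> y \<tau> = z \<tau>"
    and late: "\<And>\<tau>. p \<le> \<tau> \<Longrightarrow> \<tau> \<le> t \<Longrightarrow> \<bar>y \<tau> - z \<tau>\<bar> \<le> M"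
  shows "\<bar>frac_integral \<beta> y t - frac_integral \<beta> z t\<bar> \<le> M / Gamma (\<beta> + 1)"
proof -
  let ?K = "\<lambda>\<tau>. (t - \<tau>) powr (\<beta> - 1)"
  have M: "0 \<le> M" using late[of t] p by linarith
  have t: "0 \<le> t" using p by simp
  note int = frac_kernel_mult_integrable[OF \<beta> t y] frac_kernel_mult_integrable[OF \<beta> t z]
  \<comment> \<open>The majorant is extended by 0 to \<open>{0..t}\<close>, so that it can be
    compared with the integrand on the whole interval.\<close>
  have bound: "((\<lambda>\<tau>. if \<tau> \<in> {p..t} then ?K \<tau> * M else 0) has_integral (t - p) powr \<beta> / \<beta> * M) {0..t}"
    using has_integral_mult_left[OF has_integral_frac_kernel[OF \<beta> p(2)], of M] p
    by (subst has_integral_restrict) auto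
  have "frac_integral \<beta> y t - frac_integral \<beta> z t
      = 1 / Gamma \<beta> * integral {0..t} (\<lambda>\<tau>. ?K \<tau> * y \<tau> - ?K \<tau> * z \<tau>)"
    by (simp add: frac_integral_def Henstock_Kurzweil_Integration.integral_diff int
        right_diff_distrib)
  moreover have "norm (integral {0..t} (\<lambda>\<tau>. ?K \<tau> * y \<tau> - ?K \<tau> * z \<tau>))
      \<le> integral {0..t} (\<lambda>\<tau>. if \<tau> \<in> {p..t} then ?K \<tau> * M else 0)"
  proof (rule integral_norm_bound_integral)
    show "norm (?K \<tau> * y \<tau> - ?K \<tau> * z \<tau>) \<le> (if \<tau> \<in> {p..t} then ?K \<tau> * M else 0)"
      if "\<tau> \<in> {0..t}" for \<tau>
      using that early[of \<tau>] late[of \<tau>]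
      by (auto simp: right_diff_distrib[symmetric] abs_mult intro!: mult_left_mono)
  qed (use bound int in \<open>auto intro: integrable_diff\<close>)
  moreover have "(t - p) powr \<beta> \<le> 1"
    using p \<beta> by (intro powr_le1) auto
  then have "(t - p) powr \<beta> / \<beta> * M \<le> M / \<beta>"
    using \<beta> M by (simp add: divide_right_mono mult_left_le_one_le)
  then have "integral {0..t} (\<lambda>\<tau>. if \<tau> \<in> {p..t} then ?K \<tau> * M else 0) \<le> M / \<beta>"
    unfolding integral_unique[OF bound] .
  ultimately have eq: "\<bar>frac_integral \<beta> y t - frac_integral \<beta> z t\<bar>
        = 1 / Gamma \<beta> * \<bar>integral {0..t} (\<lambda>\<tau>. ?K \<tau> * y \<tau> - ?K \<tau> * z \<tau>)\<bar>"
      and le: "\<bar>integral {0..t} (\<lambda>\<tau>. ?K \<tau> * y \<tau> - ?K \<tau> * z \<tau>)\<bar> \<le> M / \<beta>"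
    using Gamma_real_pos[OF \<beta>] by (simp_all add: abs_mult)
  have "\<bar>frac_integral \<beta> y t - frac_integral \<beta> z t\<bar> \<le> 1 / Gamma \<beta> * (M / \<beta>)"
    unfolding eq using le Gamma_real_pos[OF \<beta>] by (intro mult_left_mono) auto
  \<comment> \<open>The functional equation
    \<open>Gamma (\<beta> + 1) = \<beta> * Gamma \<beta>\<close> absorbs the factor
    \<open>1 / \<beta>\<close>.\<close>
  also have "\<dots> = M / Gamma (\<beta> + 1)"
    using \<beta> Gamma_plus1[of \<beta>] by (auto simp: nonpos_Ints_def mult.commute)
  finally show ?thesis .
qed

section \<open>The mesh and the space of piecewise linear functions\<close>

lemma node_in_interval:
  assumes "0 < T" "j \<le> N"
  shows "node T N j \<in> {0..T}"
proof (cases "N = 0")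
  case False
  then have "real j * T \<le> real N * T" using assms by simp
  then show ?thesis using assms False by (simp add: node_def divide_simps mult.commute)
\<comment> \<open>For \<open>N = 0\<close> division by zero makes every node 0.\<close>
qed (use assms in \<open>simp add: node_def\<close>)

lemma node_mono:
  assumes "0 < T" "i \<le> j"
  shows "node T N i \<le> node T N j"
  unfolding node_def using assms by (intro mult_right_mono) auto

lemma node_Suc: "node T N (Suc j) = node T N j + T / real N"
  unfolding node_def of_nat_Suc distrib_right by simp

text \<open>The right endpoint is the first node not below \<open>t\<close>. It is not node 0, since
  \<open>t > 0\<close>, so it has a predecessor.\<close>

lemma mesh_interval_exists:
  assumes "0 < T" "0 < t" "t \<le> node T N j"
  obtains i where "i < j" "t \<in> {node T N i..node T N (Suc i)}"
proof -
  define k where "k = (LEAST k. t \<le> node T N k)"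
  have k: "t \<le> node T N k" "k \<le> j"
    unfolding k_def using assms by (auto intro: LeastI Least_le)
  moreover have "k \<noteq> 0"
  proof
    assume "k = 0"
    then show False using k(1) assms(2) by (simp add: node_def)
  qed
  then obtain i where i: "k = Suc i" using not0_implies_Suc by blast
  moreover have "\<not> t \<le> node T N i"
    using not_less_Least[of i "\<lambda>k. t \<le> node T N k"] i by (simp add: k_def)
  ultimately show ?thesis using that[of i] by auto
qed

lemma S1_affine:
  assumes "y \<in> S1 T N" "i < N"
  obtains a b where "\<And>t. t \<in> {node T N i..node T N (Suc i)} \<Longrightarrow> y t = a + b * t"
proof -
  have "Suc i \<in> {1..N}" using assms by auto
  then show ?thesis using assms that unfolding S1_def by fastforce
qed

text \<open>On one mesh interval \<open>y - z\<close> is affine and vanishes at the left end, so its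
  modulus is largest at the right end.\<close>

lemma S1_diff_le:
  assumes T: "0 < T" and y: "y \<in> S1 T N" and z: "z \<in> S1 T N" and i: "i < N"
    and eq: "y (node T N i) = z (node T N i)"
    and t: "t \<in> {node T N i..node T N (Suc i)}"
  shows "\<bar>y t - z t\<bar> \<le> \<bar>y (node T N (Suc i)) - z (node T N (Suc i))\<bar>"
proof -
  obtain a b where ab: "\<And>s. s \<in> {node T N i..node T N (Suc i)} \<Longrightarrow> y s = a + b * s"
    using S1_affine[OF y i] by blast
  obtain c d where cd: "\<And>s. s \<in> {node T N i..node T N (Suc i)} \<Longrightarrow> z s = c + d * s"
    using S1_affine[OF z i] by blast
  have mono: "node T N i \<le> node T N (Suc i)" using node_mono[OF T] by simp
  \<comment> \<open>The common value at the left node eliminates the intercepts: the difference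
    becomes the difference of slopes times the distance from that node.\<close>
  have "a + b * node T N i = c + d * node T N i" using ab cd eq mono by force
  then have eq': "a - c = - (b - d) * node T N i" by (simp add: algebra_simps)
  have "y s - z s = (b - d) * (s - node T N i)" if "s \<in> {node T N i..node T N (Suc i)}" for s
    using ab[OF that] cd[OF that] eq' by (simp add: algebra_simps)
  then show ?thesis using t mono by (auto simp: abs_mult intro!: mult_left_mono)
qed

text \<open>A point \<open>t > 0\<close> lies in a mesh interval at both ends of which
  \<open>y\<close> and \<open>z\<close> agree, so the bound by the difference at the right end is
  0.\<close>

lemma S1_eq_initial:
  assumes T: "0 < T" and y: "y \<in> S1 T N" and z: "z \<in> S1 T N" and j: "j \<le> N"
    and eq: "\<And>k. k \<le> j \<Longrightarrow> y (node T N k) = z (node T N k)"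
    and t: "0 \<le> t" "t \<le> node T N j"
  shows "y t = z t"
proof (cases "t = 0")
  case True
  then show ?thesis using eq[of 0] by (simp add: node_def)
next
  case False
  then obtain i where "i < j" "t \<in> {node T N i..node T N (Suc i)}"
    using mesh_interval_exists[OF T, of t N j] t by auto
  then show ?thesis using S1_diff_le[OF T y z, of i t] eq[of i] eq[of "Suc i"] j by auto
qed

lemma S1_eqI:
  assumes T: "0 < T" and N: "1 \<le> N" and y: "y \<in> S1 T N" and z: "z \<in> S1 T N"
    and eq: "\<And>k. k \<le> N \<Longrightarrow> y (node T N k) = z (node T N k)"
  shows "y = z"
proof (rule extensionalityI)
  show "y t = z t" if "t \<in> {0..T}" for t
    \<comment> \<open>By \<open>1 \<le> N\<close> the last node is \<open>T\<close>, so the initial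
      segment is all of \<open>{0..T}\<close>.\<close>
    by (rule S1_eq_initial[OF T y z order_refl eq]) (use that N in \<open>auto simp: node_def\<close>)
qed (use y z in \<open>auto simp: S1_def\<close>)

section \<open>Lipschitz dependence on the newest node value\<close>

text \<open>The interval is cut at the previous node: before it the two functions coincide, and
  after it their difference is at most the one at node \<open>j\<close>. At node 0 both integrals
  extend over a single point and vanish.\<close>

lemma frac_integral_S1_diff_le:
  assumes T: "0 < T" and step: "T / real N \<le> 1" and \<beta>: "0 < \<beta>"
    and y: "y \<in> S1 T N" and z: "z \<in> S1 T N" and j: "j \<le> N"
    and eq: "\<And>k. k < j \<Longrightarrow> y (node T N k) = z (node T N k)"
  shows "\<bar>frac_integral \<beta> y (node T N j) - frac_integral \<beta> z (node T N j)\<bar>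
    \<le> \<bar>y (node T N j) - z (node T N j)\<bar> / Gamma (\<beta> + 1)"
proof (cases j)
  case 0
  then show ?thesis using \<beta> Gamma_real_pos[of "\<beta> + 1"] by (simp add: frac_integral_def node_def)
next
  case (Suc i)
  have cont: "continuous_on {0..node T N j} w" if "w \<in> S1 T N" for w
    using that node_in_interval[OF T j] unfolding S1_def
    by (auto elim: continuous_on_subset)
  show ?thesis
  proof (rule frac_integral_diff_le[where p = "node T N i"])
    show "0 \<le> node T N i" using T by (simp add: node_def)
    show "node T N i \<le> node T N j" using node_mono[OF T] Suc by simp
    show "node T N j - node T N i \<le> 1" using Suc step by (simp add: node_Suc)
    show "y \<tau> = z \<tau>" if "0 \<le> \<tau>" "\<tau> < node T N i" for \<tau>
      by (rule S1_eq_initial[OF T y z, of i]) (use that Suc j eq in auto)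
    show "\<bar>y \<tau> - z \<tau>\<bar> \<le> \<bar>y (node T N j) - z (node T N j)\<bar>"
      if "node T N i \<le> \<tau>" "\<tau> \<le> node T N j" for \<tau>
      using that Suc j S1_diff_le[OF T y z, of i \<tau>] eq[of i] by simp
  qed (use \<beta> cont y z in auto)
qed

text \<open>The Taylor and Riemann-Liouville terms do not depend on the function and cancel, so each
  coordinate differs by a difference of fractional integrals only. With \<open>a 0 = 0\<close>,
  coordinate 0 fits the same pattern of order \<open>\<alpha> - a i\<close>.\<close>

lemma collocation_diff_le:
  fixes f :: "real \<Rightarrow> (nat \<Rightarrow> real) \<Rightarrow> real"
  assumes T: "0 < T" and step: "T / real N \<le> 1" and L: "0 \<le> L"
    and a_0: "a 0 = 0" and a: "\<And>i. i \<le> m \<Longrightarrow> a i < \<alpha>"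
    and f_lip: "\<forall>t\<in>{0..T}. \<forall>z\<in>coord_space m. \<forall>z'\<in>coord_space m.
                  \<bar>f t z - f t z'\<bar> \<le> L * (\<Sum>i\<le>m. \<bar>z i - z' i\<bar>)"
    and y: "y \<in> S1 T N" and z: "z \<in> S1 T N" and j: "j \<le> N"
    and eq: "\<And>k. k < j \<Longrightarrow> y (node T N k) = z (node T N k)"
  shows "\<bar>f (node T N j) (collocation_arg T m n \<alpha> a \<nu> x y (node T N j))
      - f (node T N j) (collocation_arg T m n \<alpha> a \<nu> x z (node T N j))\<bar>
    \<le> L * (\<Sum>i\<le>m. 1 / Gamma (\<alpha> - a i + 1)) * \<bar>y (node T N j) - z (node T N j)\<bar>"
    (is "?lhs \<le> _ * ?d")
proof -
  let ?A = "\<lambda>w. collocation_arg T m n \<alpha> a \<nu> x w (node T N j)"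
  have mem: "?A w \<in> coord_space m" for w
    by (simp add: collocation_arg_def coord_space_def)
  have "?lhs \<le> L * (\<Sum>i\<le>m. \<bar>?A y i - ?A z i\<bar>)"
    using f_lip node_in_interval[OF T j] mem by blast
  also have "\<dots> \<le> L * (\<Sum>i\<le>m. ?d / Gamma (\<alpha> - a i + 1))"
  proof (intro mult_left_mono sum_mono L)
    fix i assume "i \<in> {..m}"
    then have "\<bar>?A y i - ?A z i\<bar>
        = \<bar>frac_integral (\<alpha> - a i) y (node T N j) - frac_integral (\<alpha> - a i) z (node T N j)\<bar>"
      by (simp add: collocation_arg_def a_0)
    then show "\<bar>?A y i - ?A z i\<bar> \<le> ?d / Gamma (\<alpha> - a i + 1)"
      using frac_integral_S1_diff_le[OF T step _ y z j eq, of "\<alpha> - a i"] a \<open>i \<in> {..m}\<close> by simp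
  qed
  also have "\<dots> = L * (\<Sum>i\<le>m. 1 / Gamma (\<alpha> - a i + 1)) * ?d"
    by (simp add: sum_distrib_right)
  finally show ?thesis .
qed

section \<open>Interpolation of node values\<close>

text \<open>This is the expansion in the nodal basis of hat functions, with \<open>t\<close>
  measured in mesh widths. The restriction to \<open>{0..T}\<close> makes it extensional, as
  \<open>S1\<close> demands.\<close>

definition interpolant :: "real \<Rightarrow> nat \<Rightarrow> (nat \<Rightarrow> real) \<Rightarrow> real \<Rightarrow> real" where
  "interpolant T N v =
     (\<lambda>t\<in>{0..T}. \<Sum>k\<le>N. v k * max 0 (1 - \<bar>t / (T / real N) - real k\<bar>))"

lemma interpolant_node:
  assumes "0 < T" "1 \<le> N" "j \<le> N"
  shows "interpolant T N v (node T N j) = v j"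
proof -
  have "node T N j / (T / real N) = real j" using assms by (simp add: node_def)
  then have "interpolant T N v (node T N j) = (\<Sum>k\<le>N. v k * max 0 (1 - \<bar>real j - real k\<bar>))"
    using node_in_interval[OF assms(1,3)] by (simp add: interpolant_def)
  \<comment> \<open>Distinct natural numbers are at least 1 apart, so every hat function but the one
    centred at \<open>j\<close> vanishes at node \<open>j\<close>.\<close>
  also have "\<dots> = (\<Sum>k\<le>N. if k = j then v k else 0)"
    by (intro sum.cong) (auto simp: max_def)
  also have "\<dots> = v j" using assms by simp
  finally show ?thesis .
qed

text \<open>On a mesh interval only the hat functions of its two endpoints survive, and both are
  affine there.\<close>

lemma interpolant_in_S1:
  assumes T: "0 < T" and N: "1 \<le> N"
  shows "interpolant T N v \<in> S1 T N"
  unfolding S1_def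
proof (intro CollectI conjI ballI)
  show "interpolant T N v \<in> extensional {0..T}" by (simp add: interpolant_def)
  have "continuous_on {0..T} (\<lambda>t. \<Sum>k\<le>N. v k * max 0 (1 - \<bar>t / (T / real N) - real k\<bar>))"
    using assms by (intro continuous_intros) auto
  then show "continuous_on {0..T} (interpolant T N v)"
    by (rule continuous_on_eq) (simp add: interpolant_def)
next
  fix j assume j: "j \<in> {1..N}"
  define h where "h = T / real N"
  have h: "0 < h" using assms by (simp add: h_def)
  have "interpolant T N v t = (v (j - 1) * real j - v j * real (j - 1)) + ((v j - v (j - 1)) / h) * t"
    if t: "t \<in> {node T N (j - 1)..node T N j}" for t
  proof -
    have r: "real j - 1 \<le> t / h" "t / h \<le> real j"
      using t h j by (auto simp: node_def h_def[symmetric] field_simps of_nat_diff)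
    have "node T N (j - 1) \<in> {0..T}" "node T N j \<in> {0..T}"
      using node_in_interval[OF T] j by auto
    then have "t \<in> {0..T}" using t by auto
    then have "interpolant T N v t = (\<Sum>k\<le>N. v k * max 0 (1 - \<bar>t / h - real k\<bar>))"
      by (simp add: interpolant_def h_def)
    also have "\<dots> = (\<Sum>k\<in>{j - 1, j}. v k * max 0 (1 - \<bar>t / h - real k\<bar>))"
    proof (rule sum.mono_neutral_right)
      show "\<forall>k\<in>{..N} - {j - 1, j}. v k * max 0 (1 - \<bar>t / h - real k\<bar>) = 0"
      proof
        fix k assume "k \<in> {..N} - {j - 1, j}"
        \<comment> \<open>In mesh widths, any other node is at least 1 away from
          \<open>t / h\<close>, which lies between \<open>j - 1\<close> and
          \<open>j\<close>.\<close>
        then have "real k + 1 \<le> real j - 1 \<or> real j + 1 \<le> real k" using j by auto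
        then show "v k * max 0 (1 - \<bar>t / h - real k\<bar>) = 0" using r by auto
      qed
    qed (use j in auto)
    also have "\<dots> = v (j - 1) * (real j - t / h) + v j * (t / h - real (j - 1))"
      using j r by (auto simp: max_def)
    also have "\<dots> = (v (j - 1) * real j - v j * real (j - 1)) + ((v j - v (j - 1)) / h) * t"
      by (simp add: algebra_simps diff_divide_distrib)
    finally show ?thesis .
  qed
  then show "\<exists>a b. \<forall>t\<in>{node T N (j - 1)..node T N j}. interpolant T N v t = a + b * t"
    by blast
qed

section \<open>Existence and uniqueness of the collocation solution\<close>

theorem mainTheorem2:
  fixes T \<alpha> L :: real
    and m n N :: nat
    and a :: "nat \<Rightarrow> real"
    and \<nu> :: "nat \<Rightarrow> nat"
    and x :: "nat \<Rightarrow> real"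
    and f :: "real \<Rightarrow> (nat \<Rightarrow> real) \<Rightarrow> real"
  assumes T: "T > 0"
    and m: "m \<ge> 1" and n: "n \<ge> 1" and N: "N \<ge> 1"
    and \<alpha>: "real n - 1 < \<alpha>" "\<alpha> \<le> real n"
    and a_0: "a 0 = 0"
    and a_1: "a 1 < \<alpha>"
    and a_decr: "\<forall>i\<in>{1..<m}. a (Suc i) < a i"
    and a_m: "a m > 0"
    and \<nu>: "\<forall>i\<in>{1..m}. \<nu> i \<ge> 1 \<and> real (\<nu> i) - 1 < a i \<and> a i \<le> real (\<nu> i)"
    and f_cont: "\<forall>z\<in>coord_space m. continuous_on {0..T} (\<lambda>t. f t z)"
    and f_lip: "\<forall>t\<in>{0..T}. \<forall>z\<in>coord_space m. \<forall>z'\<in>coord_space m.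
                  \<bar>f t z - f t z'\<bar> \<le> L * (\<Sum>i\<le>m. \<bar>z i - z' i\<bar>)"
    and contr: "L * (\<Sum>i\<le>m. 1 / Gamma (\<alpha> - a i + 1)) < 1"
    and step: "T / real N \<le> 1"
  shows "\<exists>!y. y \<in> S1 T N \<and>
           (\<forall>j\<le>N. y (node T N j) =
              f (node T N j) (collocation_arg T m n \<alpha> a \<nu> x y (node T N j)))"
proof -
  \<comment> \<open>All the orders \<open>\<alpha> - a i\<close> have to be positive for the
    integral estimates; the decreasing chain starts from \<open>a 1 < \<alpha>\<close>.\<close>
  have a_less: "a i < \<alpha>" if "i \<le> m" for i
  proof (cases "i = 0")
    case True
    then show ?thesis using a_0 n \<alpha>(1) by simp
  next
    case False
    then have "1 \<le> i" by simp
    then show ?thesis using that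
    proof (induction i rule: dec_induct)
      case base
      show ?case by (rule a_1)
    next
      case (step k)
      then have "a (Suc k) < a k" using a_decr by simp
      then show ?case using step by simp
    qed
  qed
  \<comment> \<open>The Lipschitz bound itself yields the sign of \<open>L\<close>: it is tested on
    two constant arguments whose coordinates differ by 1 each.\<close>
  have "\<bar>f 0 (\<lambda>i\<in>{..m}. 0) - f 0 (\<lambda>i\<in>{..m}. 1)\<bar>
      \<le> L * (\<Sum>i\<le>m. \<bar>(\<lambda>i\<in>{..m}. 0 :: real) i - (\<lambda>i\<in>{..m}. 1) i\<bar>)"
    by (intro f_lip[rule_format]) (use T in \<open>auto simp: coord_space_def\<close>)
  also have "\<dots> = L * (real m + 1)" by simp
  finally have L: "0 \<le> L"
    using zero_le_mult_iff[of L "real m + 1"] by linarith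
  define c where "c = L * (\<Sum>i\<le>m. 1 / Gamma (\<alpha> - a i + 1))"
  have c0: "0 \<le> c"
    unfolding c_def
  proof (intro mult_nonneg_nonneg sum_nonneg L)
    show "0 \<le> 1 / Gamma (\<alpha> - a i + 1)" if "i \<in> {..m}" for i
      using a_less[of i] that Gamma_real_pos[of "\<alpha> - a i + 1"] by simp
  qed
  have c1: "c < 1" using contr by (simp add: c_def)
  let ?F = "\<lambda>j y. f (node T N j) (collocation_arg T m n \<alpha> a \<nu> x y (node T N j))"
  have F: "\<bar>?F j y - ?F j z\<bar> \<le> c * \<bar>y (node T N j) - z (node T N j)\<bar>"
    if "y \<in> S1 T N" "z \<in> S1 T N" "j \<le> N" "\<And>k. k < j \<Longrightarrow> y (node T N k) = z (node T N k)" for j y z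
    unfolding c_def
    by (rule collocation_diff_le[where f = f and a = a, OF T step L a_0 a_less f_lip that])
  \<comment> \<open>The unknowns are now the \<open>N + 1\<close> node values, and interpolation
    turns them into an element of \<open>S1\<close>.\<close>
  have "\<exists>v. \<forall>j<Suc N. v j = ?F j (interpolant T N v)"
  proof (rule causal_contraction_solution[where G = "\<lambda>j v. ?F j (interpolant T N v)", OF c0 c1])
    fix j and v w :: "nat \<Rightarrow> real"
    assume j: "j < Suc N" and eq: "\<And>k. k < j \<Longrightarrow> v k = w k"
    show "\<bar>?F j (interpolant T N v) - ?F j (interpolant T N w)\<bar> \<le> c * \<bar>v j - w j\<bar>"
      using F[OF interpolant_in_S1[OF T N] interpolant_in_S1[OF T N], of j v w] j eq
      by (simp add: interpolant_node[OF T N])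
  qed
  then obtain v where v: "\<And>j. j \<le> N \<Longrightarrow> v j = ?F j (interpolant T N v)"
    by (auto simp: less_Suc_eq_le)
  show ?thesis
  proof (rule ex1I[of _ "interpolant T N v"])
    show "interpolant T N v \<in> S1 T N \<and>
        (\<forall>j\<le>N. interpolant T N v (node T N j) = ?F j (interpolant T N v))"
      using interpolant_in_S1[OF T N] interpolant_node[OF T N] v by simp
  next
    fix y assume y: "y \<in> S1 T N \<and> (\<forall>j\<le>N. y (node T N j) = ?F j y)"
    let ?z = "interpolant T N v"
    \<comment> \<open>Uniqueness proceeds from node to node: once the earlier values agree, the
      difference \<open>d\<close> at node \<open>j\<close> satisfies \<open>d \<le> c * d\<close>
      with \<open>c < 1\<close>, so it is 0.\<close>
    have "y (node T N j) = ?z (node T N j)" if "j \<le> N" for j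
      using that
    proof (induction j rule: less_induct)
      case (less j)
      have "\<bar>?F j y - ?F j ?z\<bar> \<le> c * \<bar>y (node T N j) - ?z (node T N j)\<bar>"
        using less y interpolant_in_S1[OF T N] by (intro F) auto
      moreover have "?F j y = y (node T N j)" "?F j ?z = ?z (node T N j)"
        using less.prems y v interpolant_node[OF T N] by auto
      ultimately have "\<bar>y (node T N j) - ?z (node T N j)\<bar> \<le> c * \<bar>y (node T N j) - ?z (node T N j)\<bar>"
        by simp
      then have "(1 - c) * \<bar>y (node T N j) - ?z (node T N j)\<bar> \<le> 0" by (simp add: algebra_simps)
      then show ?case using c1 by (simp add: mult_le_0_iff)
    qed
    then show "y = ?z" using S1_eqI[OF T N _ interpolant_in_S1[OF T N]] y by blast
  qed
qed

end
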